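(* For any symplectic matrix $H\in\mathbb{R}^{2d\times 2d}$ there exist symmetric $S,T,U\in\mathbb{R}^{d\times d}$ and a nonsingular $P\in\mathbb{R}^{d\times d}$ such that $$H=\begin{bmatrix} I & S \\ 0 & I \end{bmatrix}\begin{bmatrix}P & \star \\ \star & \star \end{bmatrix}=\begin{bmatrix} I & S \\ 0 & I \end{bmatrix}\begin{bmatrix} I & 0 \\ T & I \end{bmatrix}\begin{bmatrix} I & U \\ 0 & I \end{bmatrix}\begin{bmatrix} P & 0 \\ 0 & P^{-T} \end{bmatrix}.$$ Furthermore, in such a factorization $T,U,P$ are uniquely determined by $H$ and $S$.
   Context: Let $I=I_d$ and $J=\begin{bmatrix} 0 & I_{d} \\ -I_{d} & 0 \end{bmatrix}$. A matrix $H\in\mathbb{R}^{2d\times 2d}$ is symplectic if $H^{T}JH=J$. All blocks are $d\times d$; $\star$ denotes unspecified blocks; $P^{-T}=(P^{-1})^{T}$. *)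

theory Defs
  imports "HOL-Analysis.Analysis"
begin

(* A 2d x 2d matrix is indexed by the sum type 'd + 'd, where CARD('d) = d: Inl is the
   first (upper / left) half of the indices, Inr the second (lower / right) half.
   The arguments are the blocks A B / C D, read row by row. *)
definition block_mat ::
  "'a^'d::finite^'d \<Rightarrow> 'a^'d^'d \<Rightarrow> 'a^'d^'d \<Rightarrow> 'a^'d^'d \<Rightarrow> 'a^('d + 'd)^('d + 'd)"
  where "block_mat A B C D =
    (\<chi> i j. case i of
        Inl k \<Rightarrow> (case j of Inl l \<Rightarrow> A $ k $ l | Inr l \<Rightarrow> B $ k $ l)
      | Inr k \<Rightarrow> (case j of Inl l \<Rightarrow> C $ k $ l | Inr l \<Rightarrow> D $ k $ l))"

definition J_mat :: "real^('d::finite + 'd)^('d + 'd)"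
  where "J_mat = block_mat 0 (mat 1) (- mat 1) 0"

definition symplectic :: "real^('d::finite + 'd)^('d + 'd) \<Rightarrow> bool"
  where "symplectic H \<longleftrightarrow> transpose H ** J_mat ** H = J_mat"

definition symmetric_mat :: "'a^'d::finite^'d \<Rightarrow> bool"
  where "symmetric_mat A \<longleftrightarrow> transpose A = A"

(* X, Y, Z are the unspecified blocks of the middle expression. *)
definition symplectic_factorization ::
  "real^('d::finite + 'd)^('d + 'd) \<Rightarrow> real^'d^'d \<Rightarrow> real^'d^'d \<Rightarrow> real^'d^'d \<Rightarrow> real^'d^'d \<Rightarrow> bool"
  where "symplectic_factorization H S T U P \<longleftrightarrow>
    symmetric_mat S \<and> symmetric_mat T \<and> symmetric_mat U \<and> invertible P \<and>
    (\<exists>X Y Z. H = block_mat (mat 1) S 0 (mat 1) ** block_mat P X Y Z \<and>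
       block_mat (mat 1) S 0 (mat 1) ** block_mat P X Y Z =
         block_mat (mat 1) S 0 (mat 1) ** block_mat (mat 1) 0 T (mat 1)
           ** block_mat (mat 1) U 0 (mat 1) ** block_mat P 0 0 (transpose (matrix_inv P)))"

end

theory Submission
  imports Defs
begin

text \<open>Let \<open>A\<close>, \<open>C\<close> be the left blocks of \<open>H\<close>. For all but finitely many real \<open>t\<close> the matrix
  \<open>A - tC\<close> is invertible, so \<open>S\<close> can be taken to be a multiple of the identity. Multiplying
  by the shear with \<open>-S\<close> reduces to a symplectic matrix with invertible upper left block \<open>P\<close>;
  the block equations then determine \<open>T\<close> and \<open>U\<close>, and symplecticity makes them symmetric.\<close>

section \<open>Arithmetic of block matrices and the symplectic relations\<close>

lemma sum_UNIV_Plus: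
  fixes f :: "'a::finite + 'b::finite \<Rightarrow> 'c::comm_monoid_add"
  shows "sum f UNIV = (\<Sum>i\<in>UNIV. f (Inl i)) + (\<Sum>j\<in>UNIV. f (Inr j))"
  by (simp add: UNIV_Plus_UNIV [symmetric] sum.Plus del: UNIV_Plus_UNIV)

lemma block_mat_nth [simp]:
  "block_mat A B C D $ Inl i $ Inl j = A $ i $ j"
  "block_mat A B C D $ Inl i $ Inr j = B $ i $ j"
  "block_mat A B C D $ Inr i $ Inl j = C $ i $ j"
  "block_mat A B C D $ Inr i $ Inr j = D $ i $ j"
  by (simp_all add: block_mat_def)

lemma block_mat_exhaust:
  obtains A B C D where "H = block_mat A B C D"
proof
  show "H = block_mat (\<chi> i j. H $ Inl i $ Inl j) (\<chi> i j. H $ Inl i $ Inr j)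
              (\<chi> i j. H $ Inr i $ Inl j) (\<chi> i j. H $ Inr i $ Inr j)"
    by (simp add: vec_eq_iff split_sum_all)
qed

lemma block_mat_eq_iff [simp]:
  "block_mat A B C D = block_mat A' B' C' D' \<longleftrightarrow> A = A' \<and> B = B' \<and> C = C' \<and> D = D'"
  by (auto simp: vec_eq_iff split_sum_all)

lemma block_mat_mult:
  fixes A :: "'a::semiring_1^'d::finite^'d"
  shows "block_mat A B C D ** block_mat A' B' C' D' =
    block_mat (A ** A' + B ** C') (A ** B' + B ** D') (C ** A' + D ** C') (C ** B' + D ** D')"
  by (simp add: vec_eq_iff split_sum_all matrix_matrix_mult_def sum_UNIV_Plus)

lemma transpose_block_mat:
  "transpose (block_mat A B C D) = block_mat (transpose A) (transpose C) (transpose B) (transpose D)"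
  by (simp add: vec_eq_iff split_sum_all transpose_def)

lemma mat_1_eq_block_mat: "mat 1 = block_mat (mat 1) 0 0 (mat 1)"
  by (simp add: vec_eq_iff split_sum_all mat_def)

lemma matrix_mult_zero [simp]:
  "(0 :: 'a::semiring_1^'n::finite^'m) ** B = 0"
  "(A :: 'a^'n^'m) ** 0 = 0"
  by (simp_all add: vec_eq_iff matrix_matrix_mult_def)

lemma matrix_mult_minus [simp]:
  fixes A :: "'a::ring_1^'n::finite^'m"
  shows "(- A) ** B = - (A ** B)" "A ** (- B) = - (A ** B)"
  by (simp_all add: vec_eq_iff matrix_matrix_mult_def sum_negf)

lemma matrix_add_rdistrib: "(A + B) ** C = A ** C + B ** C"
  by (simp add: vec_eq_iff matrix_matrix_mult_def sum.distrib distrib_right)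

lemma transpose_arith [simp]:
  "transpose 0 = 0"
  "transpose (- A) = - transpose A"
  "transpose (A + B) = transpose A + transpose B"
  "transpose (A - B) = transpose A - transpose B"
  by (simp_all add: vec_eq_iff transpose_def)

lemma mat_mult_vector: "mat (t::real) *v x = t *\<^sub>R x"
  by (simp add: vec_eq_iff matrix_vector_mult_def mat_def if_distrib if_distribR cong: if_cong)

lemma matrix_inv_mult:
  assumes "invertible A"
  shows "A ** matrix_inv A = mat 1" "matrix_inv A ** A = mat 1"
  using someI_ex [OF assms [unfolded invertible_def]] by (simp_all add: matrix_inv_def)

lemma invertible_iff_ker:
  fixes A :: "real^'n::finite^'n"
  shows "invertible A \<longleftrightarrow> (\<forall>x. A *v x = 0 \<longrightarrow> x = 0)"
  by (simp add: invertible_left_inverse matrix_left_invertible_ker)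

text \<open>The two off-diagonal block equations of H^T J H = J are transposes of each other up to
  sign, so only one of them has to be listed.\<close>

lemma symplectic_block_mat_iff:
  "symplectic (block_mat A B C D) \<longleftrightarrow>
    transpose A ** C = transpose C ** A \<and> transpose B ** D = transpose D ** B \<and>
    transpose A ** D - transpose C ** B = mat 1" (is "?L \<longleftrightarrow> ?R")
proof -
  have "?L \<longleftrightarrow> transpose A ** C = transpose C ** A \<and> transpose B ** D = transpose D ** B \<and>
    transpose A ** D - transpose C ** B = mat 1 \<and> transpose B ** C - transpose D ** A = - mat 1"
    unfolding symplectic_def J_mat_def
    by (auto simp: block_mat_mult transpose_block_mat algebra_simps)
  moreover have "transpose B ** C - transpose D ** A = - mat 1"
    if "transpose A ** D - transpose C ** B = mat 1"
    using arg_cong [OF that, of transpose] by (simp add: matrix_transpose_mul algebra_simps)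
  ultimately show ?thesis
    by blast
qed

lemma symplectic_mult:
  assumes "symplectic G" "symplectic H"
  shows "symplectic (G ** H)"
proof -
  have "transpose (G ** H) ** J_mat ** (G ** H) = transpose H ** (transpose G ** J_mat ** G) ** H"
    by (simp add: matrix_transpose_mul matrix_mul_assoc)
  with assms show ?thesis
    by (simp add: symplectic_def)
qed

lemma block_shear_cancel:
  fixes S :: "real^'d::finite^'d"
  shows "block_mat (mat 1) S 0 (mat 1) ** (block_mat (mat 1) (- S) 0 (mat 1) ** H) = H"
proof -
  have "block_mat (mat 1) S 0 (mat 1) ** block_mat (mat 1) (- S) 0 (mat 1) = mat 1"
    by (simp add: block_mat_mult mat_1_eq_block_mat)
  then show ?thesis
    by (simp add: matrix_mul_assoc)
qed

section \<open>Obtaining and factoring an invertible upper left block\<close>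

text \<open>A kernel vector of \<open>A - tC\<close> is a generalized eigenvector \<open>Av = tCv\<close>. Since
  \<open>A\<^sup>T C\<close> is symmetric, the vectors \<open>Cv\<close> belonging to distinct \<open>t\<close> are orthogonal, and by
  the rank condition they are nonzero, so only finitely many \<open>t\<close> are singular.\<close>

lemma finite_singular_pencil:
  fixes A C :: "real^'d::finite^'d"
  assumes sym: "transpose A ** C = transpose C ** A"
    and ker: "\<And>x. A *v x = 0 \<Longrightarrow> C *v x = 0 \<Longrightarrow> x = 0"
  shows "finite {t. \<not> invertible (A - mat t ** C)}" (is "finite ?E")
proof -
  have "\<forall>t\<in>?E. \<exists>v. v \<noteq> 0 \<and> A *v v = t *\<^sub>R (C *v v)"
    by (auto simp: invertible_iff_ker matrix_vector_mult_diff_rdistrib mat_mult_vector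
        matrix_vector_mul_assoc [symmetric])
  then obtain v where v: "\<And>t. t \<in> ?E \<Longrightarrow> v t \<noteq> 0"
    and Av: "\<And>t. t \<in> ?E \<Longrightarrow> A *v v t = t *\<^sub>R (C *v v t)"
    by metis
  have nz: "C *v v t \<noteq> 0" if "t \<in> ?E" for t
    using ker [of "v t"] v [OF that] Av [OF that] by auto
  have adj: "inner (A *v x) (C *v y) = inner (C *v x) (A *v y)" for x y
  proof -
    have "inner (A *v x) (C *v y) = inner x ((transpose A ** C) *v y)"
      using dot_lmul_matrix [of "C *v y" A x]
      by (simp add: inner_commute matrix_vector_mul_assoc [symmetric])
    also have "\<dots> = inner (C *v x) (A *v y)"
      using dot_lmul_matrix [of "A *v y" C x]
      by (simp add: sym inner_commute matrix_vector_mul_assoc [symmetric])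
    finally show ?thesis .
  qed
  \<comment> \<open>With both eigenvector equations inserted, \<open>adj\<close> says that s times
    this inner product equals t times it.\<close>
  have orth: "inner (C *v v s) (C *v v t) = 0" if "s \<in> ?E" "t \<in> ?E" "s \<noteq> t" for s t
    using adj [of "v s" "v t"] that by (simp add: Av)
  \<comment> \<open>Linear independence bounds only the set of vectors; injectivity carries
    finiteness back to the parameters. Equal vectors for distinct parameters would be
    self-orthogonal, hence zero.\<close>
  have inj: "inj_on (\<lambda>t. C *v v t) ?E"
  proof (rule inj_onI, rule ccontr)
    fix s t assume "s \<in> ?E" "t \<in> ?E" "C *v v s = C *v v t" "s \<noteq> t"
    then show False
      using orth [of s t] nz [of s] by simp
  qed
  have "pairwise orthogonal ((\<lambda>t. C *v v t) ` ?E)"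
    unfolding pairwise_def orthogonal_def using orth by blast
  then have "independent ((\<lambda>t. C *v v t) ` ?E)"
    using nz by (intro pairwise_orthogonal_independent) auto
  then have "finite ((\<lambda>t. C *v v t) ` ?E)"
    by (rule independent_imp_finite)
  then show ?thesis
    using inj by (rule finite_imageD)
qed

text \<open>With R = P^-1, the product has block rows (P, U R^T) and (T P, (I + T U) R^T). This
  forces T = C R and U = Q P^T; the symplectic relations supply the symmetry of both and the lower
  right block.\<close>

lemma symplectic_invertible_corner:
  fixes P Q C D :: "real^'d::finite^'d"
  assumes symp: "symplectic (block_mat P Q C D)" and inv: "invertible P"
  obtains T U where "symmetric_mat T" "symmetric_mat U"
    "block_mat P Q C D = block_mat (mat 1) 0 T (mat 1) ** block_mat (mat 1) U 0 (mat 1)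
        ** block_mat P 0 0 (transpose (matrix_inv P))"
proof
  define R where "R = matrix_inv P"
  have PR: "P ** R = mat 1" and RP: "R ** P = mat 1"
    using inv by (auto simp: R_def matrix_inv_mult)
  have tPR: "transpose R ** transpose P = mat 1" and tRP: "transpose P ** transpose R = mat 1"
    using arg_cong [OF PR, of transpose] arg_cong [OF RP, of transpose]
    by (simp_all add: matrix_transpose_mul)
  have PC: "transpose P ** C = transpose C ** P" and QD: "transpose Q ** D = transpose D ** Q"
    and PD: "transpose P ** D - transpose C ** Q = mat 1"
    using symp by (auto simp: symplectic_block_mat_iff)
  define T where "T = C ** R"
  define U where "U = Q ** transpose P"
  have CT: "C = T ** P"
    by (simp add: T_def matrix_mul_assoc [symmetric] RP)
  have QU: "Q = U ** transpose R"
    by (simp add: U_def matrix_mul_assoc [symmetric] tRP)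
  \<comment> \<open>Inserting P R = I exhibits the transpose as a congruence of the symmetric matrix
    C^T P.\<close>
  have "transpose T = transpose R ** transpose C ** (P ** R)"
    by (simp add: T_def matrix_transpose_mul PR)
  also have "\<dots> = transpose R ** (transpose C ** P) ** R"
    by (simp add: matrix_mul_assoc)
  also have "\<dots> = (transpose R ** transpose P) ** C ** R"
    by (simp add: PC [symmetric] matrix_mul_assoc)
  finally have T: "transpose T = T"
    by (simp add: T_def tPR)
  \<comment> \<open>The relation P^T D - C^T Q = I is solved for D.\<close>
  have "D = transpose R ** (transpose P ** D)"
    by (simp add: matrix_mul_assoc tPR)
  also have "transpose P ** D = mat 1 + transpose C ** Q"
    using PD by (simp add: algebra_simps)
  also have "transpose R ** \<dots> = transpose R + transpose T ** Q"
    by (simp add: matrix_add_ldistrib matrix_mul_assoc T_def matrix_transpose_mul)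
  finally have D: "D = transpose R + T ** Q"
    by (simp add: T)
  \<comment> \<open>After substituting D into Q^T D = D^T Q, the term Q^T T Q occurs on both sides
    and cancels.\<close>
  have "transpose Q ** transpose R = R ** Q"
    using QD by (simp add: D matrix_transpose_mul matrix_add_ldistrib matrix_add_rdistrib
        matrix_mul_assoc T)
  \<comment> \<open>This conjugation reduces to P Q^T = Q P^T, which is the symmetry of U.\<close>
  then have "P ** (transpose Q ** transpose R) ** transpose P = P ** (R ** Q) ** transpose P"
    by simp
  then have U: "transpose U = U"
    by (simp add: U_def matrix_transpose_mul matrix_mul_assoc PR)
      (simp add: matrix_mul_assoc [symmetric] tPR)
  show "symmetric_mat T" "symmetric_mat U"
    by (simp_all add: symmetric_mat_def T U)
  show "block_mat P Q C D = block_mat (mat 1) 0 T (mat 1) ** block_mat (mat 1) U 0 (mat 1)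
      ** block_mat P 0 0 (transpose (matrix_inv P))"
    unfolding R_def [symmetric]
    by (simp add: block_mat_mult D CT [symmetric] QU [symmetric] matrix_add_rdistrib
        matrix_mul_assoc [symmetric])
qed

section \<open>Existence of the factorization\<close>

lemma symplectic_factorization_exists:
  fixes H :: "real^('d::finite + 'd)^('d + 'd)"
  assumes symp: "symplectic H"
  shows "\<exists>S T U P. symplectic_factorization H S T U P"
proof -
  obtain A B C D where H: "H = block_mat A B C D"
    by (rule block_mat_exhaust)
  have AC: "transpose A ** C = transpose C ** A"
    and AD: "transpose A ** D - transpose C ** B = mat 1"
    using symp by (auto simp: H symplectic_block_mat_iff)
  \<comment> \<open>The transposed relation D^T A - B^T C = I gives a left inverse of the block
    column formed by A and C.\<close>
  have ker: "x = 0" if "A *v x = 0" "C *v x = 0" for x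
  proof -
    have "transpose D ** A - transpose B ** C = mat 1"
      using arg_cong [OF AD, of transpose] by (simp add: matrix_transpose_mul)
    then have "x = (transpose D ** A - transpose B ** C) *v x"
      by simp
    also have "\<dots> = 0"
      using that by (simp add: matrix_vector_mult_diff_rdistrib matrix_vector_mul_assoc [symmetric])
    finally show ?thesis .
  qed
  have "finite {t. \<not> invertible (A - mat t ** C)}"
    using AC ker by (rule finite_singular_pencil)
  then obtain t where t: "invertible (A - mat t ** C)"
    using ex_new_if_finite [OF infinite_UNIV_char_0] by blast
  define S :: "real^'d^'d" where "S = mat t"
  define G where "G = block_mat (mat 1) (- S) 0 (mat 1) ** H"
  have G: "G = block_mat (A - S ** C) (B - S ** D) C D"
    by (simp add: G_def H block_mat_mult)
  \<comment> \<open>The shear by -S is symplectic because S, a multiple of the identity, is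
    symmetric.\<close>
  have "symplectic G"
    unfolding G_def using symp
    by (intro symplectic_mult) (simp_all add: symplectic_block_mat_iff S_def)
  then obtain T U where TU: "symmetric_mat T" "symmetric_mat U"
    "G = block_mat (mat 1) 0 T (mat 1) ** block_mat (mat 1) U 0 (mat 1)
      ** block_mat (A - S ** C) 0 0 (transpose (matrix_inv (A - S ** C)))"
    using t unfolding G S_def [symmetric] by (rule symplectic_invertible_corner)
  have HG: "H = block_mat (mat 1) S 0 (mat 1) ** G"
    by (simp add: G_def block_shear_cancel)
  have "symplectic_factorization H S T U (A - S ** C)"
    unfolding symplectic_factorization_def
  proof (intro conjI exI)
    \<comment> \<open>The unspecified blocks are the remaining blocks of \<open>G\<close>.\<close>
    show "H = block_mat (mat 1) S 0 (mat 1) ** block_mat (A - S ** C) (B - S ** D) C D"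
      using HG by (simp add: G)
    show "block_mat (mat 1) S 0 (mat 1) ** block_mat (A - S ** C) (B - S ** D) C D =
      block_mat (mat 1) S 0 (mat 1) ** block_mat (mat 1) 0 T (mat 1)
        ** block_mat (mat 1) U 0 (mat 1)
        ** block_mat (A - S ** C) 0 0 (transpose (matrix_inv (A - S ** C)))"
      unfolding G [symmetric] by (subst TU(3)) (simp add: matrix_mul_assoc)
  qed (use t TU in \<open>simp_all add: S_def symmetric_mat_def\<close>)
  then show ?thesis
    by blast
qed

section \<open>Uniqueness of the factorization for given H and S\<close>

lemma symplectic_factorization_blocks:
  assumes "symplectic_factorization (block_mat A B C D) S T U P"
  shows "P = A - S ** C" "invertible P" "T = C ** matrix_inv P" "U = (B - S ** D) ** transpose P"
proof -
  show inv: "invertible P"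
    using assms by (simp add: symplectic_factorization_def)
  have PR: "P ** matrix_inv P = mat 1" and RP: "matrix_inv P ** P = mat 1"
    using inv by (auto simp: matrix_inv_mult)
  have tRP: "transpose (matrix_inv P) ** transpose P = mat 1"
    using arg_cong [OF PR, of transpose] by (simp add: matrix_transpose_mul)
  \<comment> \<open>The outer shear leaves the lower block row alone, so C and D are also the lower
    blocks of the bracketed product. Comparing the other blocks gives P from H and S.\<close>
  have "block_mat A B C D = block_mat (mat 1) S 0 (mat 1) **
    (block_mat (mat 1) 0 T (mat 1) ** block_mat (mat 1) U 0 (mat 1)
      ** block_mat P 0 0 (transpose (matrix_inv P)))"
    using assms by (auto simp: symplectic_factorization_def matrix_mul_assoc)
  then have A: "A = P + S ** C" and B: "B = U ** transpose (matrix_inv P) + S ** D" and C: "C = T ** P"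
    by (simp_all add: block_mat_mult)
  show "P = A - S ** C"
    by (simp add: A)
  show "T = C ** matrix_inv P"
    by (simp add: C matrix_mul_assoc [symmetric] PR)
  show "U = (B - S ** D) ** transpose P"
    by (simp add: B matrix_mul_assoc [symmetric] tRP)
qed

theorem lemma1:
  fixes H :: "real^('d::finite + 'd)^('d + 'd)"
  assumes "symplectic H"
  shows "(\<exists>S T U P. symplectic_factorization H S T U P) \<and>
    (\<forall>S T U P T' U' P'.
      symplectic_factorization H S T U P \<longrightarrow> symplectic_factorization H S T' U' P' \<longrightarrow>
      T = T' \<and> U = U' \<and> P = P')"
proof (intro conjI allI impI)
  show "\<exists>S T U P. symplectic_factorization H S T U P"
    using assms by (rule symplectic_factorization_exists)
next
  fix S T U P T' U' P'
  assume F: "symplectic_factorization H S T U P" "symplectic_factorization H S T' U' P'"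
  obtain A B C D where H: "H = block_mat A B C D"
    by (rule block_mat_exhaust)
  note f = symplectic_factorization_blocks [OF F(1) [unfolded H]]
    and f' = symplectic_factorization_blocks [OF F(2) [unfolded H]]
  \<comment> \<open>P is settled first, since the formulas for T and U involve it.\<close>
  show P: "P = P'"
    using f(1) f'(1) by simp
  show "T = T'"
    using f(3) f'(3) P by simp
  show "U = U'"
    using f(4) f'(4) P by simp
qed

end
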